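(* Fix an integer $C\ge-1$ and $n\ge N_C$. The map $$\mu_m\pi_1\cdots\pi_\ell\ \longmapsto\ \mathcal E_n(m,\pi),\qquad \pi=(\pi_1,\dots,\pi_\ell),$$ is a bijection from the words accepted by the automaton $\mathcal M_C$ (defined in the context) to the exceptional primitive sets.
   Context: Subset sums and partitions. For a finite set $A\subset\mathbb R_{>0}$, $\mathrm{FS}(A)=\{\sum_{a\in X}a:X\subseteq A\}$ (empty sum included); $T_n=\binom{n+1}{2}$; $[u,v]_{\mathbb Z}=\{u,\dots,v\}$, empty if $u>v$. A finite set $B\subset\mathbb Z_{>0}$ is primitive if $\gcd(B)=1$. For an integer $w$, $\mathcal P(w)$ is the set of weakly increasing positive integer partitions $\pi=(\pi_1,\dots,\pi_\ell)$ with $|\pi|=\sum_r\pi_r=w$; $\mathcal P(0)=\{()\}$, $\mathcal P(w)=\varnothing$ for $w<0$; $\ell(\pi)$ is the number of parts. For $m\in\{1,2\}$, $$\mathcal E_n(m,\pi)=\bigl([1,n-\ell(\pi)+1]_{\mathbb Z}\setminus\{m\}\bigr)\cup\{\,n-\ell(\pi)+r+1+\pi_r:1\le r\le\ell(\pi)\,\}.$$ Exceptional primitive sets (for given $C,n$): the primitive $n$-element sets $B\subset\mathbb Z_{>0}$ with $|\mathrm{FS}(B)|\le T_n+n+C+1$ that are of the form $B=\lambda\,\mathcal E_n(m,\pi)$ with $\lambda>0$, $m\in\{1,2\}$ and $\pi\in\mathcal P(C+m)\cup\mathcal P(C+m+1)$. The automaton $\mathcal M_C$. Put $U_C=C+3$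 and $W_{m,C}=\{C+m,C+m+1\}\cap\mathbb Z_{\ge0}$. The alphabet is $\mathcal A_C=\{\mu_1,\mu_2\}\cup[1,U_C]_{\mathbb Z}$, where $\mu_1,\mu_2$ are two marker symbols. The state set is $\{q_{\mathrm{start}},q_{\mathrm{dead}}\}\cup\{(m,r,s):m\in\{1,2\},\ 0\le r,s\le U_C\}$ ($r,s$ integers), with initial state $q_{\mathrm{start}}$. Transitions: from $q_{\mathrm{start}}$, the letter $\mu_m$ leads to $(m,0,0)$; from $(m,r,s)$, an integer letter $a$ leads to $(m,a,s+a)$ if $a\ge\max\{1,r\}$ and $s+a\le U_C$; every other transition leads to $q_{\mathrm{dead}}$, and every letter sends $q_{\mathrm{dead}}$ to itself. A state $(m,r,s)$ is accepting precisely when $s\in W_{m,C}$; $q_{\mathrm{start}}$ and $q_{\mathrm{dead}}$ are not accepting. (The word $\mu_m$ alone encodes the empty partition.) Constants. For $E\in\mathbb Z_{\ge0}$, $I_E=\max\{2E+5,\,1+\lfloor33+8\sqrt{E+16}\rfloor\}$. Put $r_C=\max(\{3\}\cup\{r\in\mathbb Z_{\ge4}:\frac{r^2-5r+2}{2}\le C\})$, $s_C=\max\{4,r_C\}$, $D_C^{\mathrm{rk}}=\max\{0,C+s_C-1\}$, $J_C^{\mathrm{rk}}=\max\{I_1,s_C\}$, $N_C^{\mathrm{rk}}=J_C^{\mathrm{rk}}+D_C^{\mathrm{rk}}$; $K_C=\max(\{2\}\cup\{k\in\mathbb Z_{\ge3}:\frac{k(k-3)}2\le C+1\})$, $D_C=\max\{0,C+3,C+K_C\}$,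 $R_C=\max\{4,K_C+1\}$, $E_C=D_C+1$; $Q_C$ is the least positive integer with $\frac{Q_C(Q_C-1)}2-1>D_C$; $M(h,q,E)=\max\bigl\{h,\,1+\bigl\lfloor\frac{1+\sqrt{9+8(E+2q+2h)}}2\bigr\rfloor\bigr\}$, $M_C=M(2,1,E_C)$, $J_C=\max\{I_1,R_C,M_C,Q_C\}$; and $$N_C=\max\{1-C,\ N_C^{\mathrm{rk}},\ J_C+D_C\}.$$ *)

theory Defs
  imports Complex_Main
begin

section \<open>Subset sums, partitions, and exceptional sets\<close>

definition FS :: "'a::comm_monoid_add set \<Rightarrow> 'a set" where
  "FS A = {\<Sum>a\<in>X. a | X. X \<subseteq> A}"

definition T :: "nat \<Rightarrow> nat" where
  "T n = (n + 1) choose 2"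

text \<open>Empty for negative \<^term>\<open>w\<close>.\<close>

definition partitions :: "int \<Rightarrow> int list set" where
  "partitions w = {p. sorted p \<and> (\<forall>a\<in>set p. 0 < a) \<and> sum_list p = w}"

text \<open>The part \<open>\<pi>\<^sub>r\<close> is \<open>p ! (r - 1)\<close>. Integers are used so that
  \<open>n - \<ell>(\<pi>)\<close> is not truncated.\<close>

definition E_set :: "nat \<Rightarrow> int \<Rightarrow> int list \<Rightarrow> int set" where
  "E_set n m p =
     ({1 .. int n - int (length p) + 1} - {m}) \<union>
     {int n - int (length p) + int r + 1 + p ! (r - 1) | r. 1 \<le> r \<and> r \<le> length p}"

definition primitive :: "int set \<Rightarrow> bool" where
  "primitive B \<longleftrightarrow> finite B \<and> (\<forall>b\<in>B. 0 < b) \<and> Gcd B = 1"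

text \<open>The scaling factor \<open>l\<close> is an arbitrary positive real, hence the comparison
  of \<open>B\<close> with the dilate takes place in the reals.\<close>

definition exceptional :: "int \<Rightarrow> nat \<Rightarrow> int set set" where
  "exceptional C n =
     {B. primitive B \<and> card B = n \<and>
         int (card (FS B)) \<le> int (T n) + int n + C + 1 \<and>
         (\<exists>l::real. \<exists>m p. 0 < l \<and> m \<in> {1, 2} \<and>
            p \<in> partitions (C + m) \<union> partitions (C + m + 1) \<and>
            real_of_int ` B = (\<lambda>x. l * real_of_int x) ` E_set n m p)}"


section \<open>The automaton\<close>

record ('q, 'a) dfa =
  states :: "'q set"
  alphabet :: "'a set"
  init :: 'q
  trans :: "'q \<Rightarrow> 'a \<Rightarrow> 'q"
  accepting :: "'q set"

definition wf_dfa :: "('q, 'a) dfa \<Rightarrow> bool" where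
  "wf_dfa M \<longleftrightarrow> finite (states M) \<and> finite (alphabet M) \<and>
     init M \<in> states M \<and> accepting M \<subseteq> states M \<and>
     (\<forall>q\<in>states M. \<forall>a\<in>alphabet M. trans M q a \<in> states M)"

definition accepted_words :: "('q, 'a) dfa \<Rightarrow> 'a list set" where
  "accepted_words M =
     {w \<in> lists (alphabet M). foldl (trans M) (init M) w \<in> accepting M}"

datatype letter = Marker int | Part (part: int)

datatype state = Start | Dead | Node int int int

definition U :: "int \<Rightarrow> int" where
  "U C = C + 3"

definition W :: "int \<Rightarrow> int \<Rightarrow> int set" where
  "W m C = {C + m, C + m + 1} \<inter> {0..}"

fun step :: "int \<Rightarrow> state \<Rightarrow> letter \<Rightarrow> state" where
  "step C Start (Marker m) = (if m \<in> {1, 2} then Node m 0 0 else Dead)"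
| "step C (Node m r s) (Part a) =
     (if max 1 r \<le> a \<and> s + a \<le> U C then Node m a (s + a) else Dead)"
| "step C _ _ = Dead"

definition automaton :: "int \<Rightarrow> (state, letter) dfa" where
  "automaton C =
     \<lparr> states = {Start, Dead} \<union>
         {Node m r s | m r s. m \<in> {1, 2} \<and> r \<in> {0..U C} \<and> s \<in> {0..U C}},
       alphabet = {Marker 1, Marker 2} \<union> Part ` {1..U C},
       init = Start,
       trans = step C,
       accepting =
         {Node m r s | m r s. m \<in> {1, 2} \<and> r \<in> {0..U C} \<and> s \<in> {0..U C} \<and> s \<in> W m C} \<rparr>"

definition word :: "int \<Rightarrow> int list \<Rightarrow> letter list" where
  "word m p = Marker m # map Part p"

text \<open>The map from words to sets. Only its values on words of the form
  \<^term>\<open>word m p\<close> matter: by \<open>accepted_word_form\<close> below, every accepted word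
  is of this form.\<close>

fun word_set :: "nat \<Rightarrow> letter list \<Rightarrow> int set" where
  "word_set n (Marker m # u) = E_set n m (map part u)"
| "word_set n _ = {}"

lemma word_set_word: "word_set n (word m p) = E_set n m p"
  by (simp add: word_def comp_def)

lemma foldl_step_Dead: "foldl (step C) Dead w = Dead"
  by (induction w) auto

lemma foldl_step_Node:
  "foldl (step C) (Node m r s) w \<noteq> Dead \<Longrightarrow> \<exists>p. w = map Part p"
proof (induction w arbitrary: r s)
  case (Cons a w)
  show ?case
  proof (cases a)
    case (Part x)
    with Cons.prems have "foldl (step C) (Node m x (s + x)) w \<noteq> Dead"
      by (auto simp: foldl_step_Dead split: if_splits)
    from Cons.IH[OF this] obtain p where "w = map Part p" by blast
    with Part have "a # w = map Part (x # p)" by simp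
    then show ?thesis by (rule exI)
  qed (use Cons.prems in \<open>simp add: foldl_step_Dead\<close>)
qed simp

lemma accepted_word_form:
  assumes "w \<in> accepted_words (automaton C)"
  obtains m p where "m \<in> {1, 2}" "w = word m p"
proof -
  have acc: "foldl (step C) Start w \<noteq> Dead" "foldl (step C) Start w \<noteq> Start"
    using assms by (auto simp: accepted_words_def automaton_def)
  then obtain a u where w: "w = a # u" by (cases w) auto
  with acc obtain m where m: "a = Marker m" "m \<in> {1, 2}"
    by (cases a) (auto simp: foldl_step_Dead split: if_splits)
  with acc w obtain p where "u = map Part p"
    using foldl_step_Node[of C m 0 0 u] by auto
  with m w show thesis by (auto intro: that simp: word_def)
qed

lemma wf_automaton:
  assumes "C \<ge> -1"
  shows "wf_dfa (automaton C)"
proof -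
  have "{Node m r s | m r s. m \<in> {1, 2} \<and> r \<in> {0..U C} \<and> s \<in> {0..U C}} =
      (\<lambda>(m, r, s). Node m r s) ` ({1, 2} \<times> {0..U C} \<times> {0..U C})"
    by force
  then have fin: "finite (states (automaton C))"
    unfolding automaton_def by simp
  have "trans (automaton C) q a \<in> states (automaton C)"
    if "q \<in> states (automaton C)" "a \<in> alphabet (automaton C)" for q a
    using that assms by (cases q; cases a) (auto simp: automaton_def U_def)
  then show ?thesis
    using fin unfolding wf_dfa_def by (auto simp: automaton_def)
qed


section \<open>Constants\<close>

definition I_const :: "int \<Rightarrow> int" where
  "I_const E = max (2 * E + 5) (1 + \<lfloor>33 + 8 * sqrt (real_of_int E + 16)\<rfloor>)"

text \<open>The sets whose maximum is taken here and in \<open>K_const\<close> are finite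
  (\<open>finite_r_set\<close>, \<open>finite_K_set\<close>).\<close>

definition r_const :: "int \<Rightarrow> int" where
  "r_const C = Max ({3} \<union> {r. 4 \<le> r \<and> real_of_int (r\<^sup>2 - 5 * r + 2) / 2 \<le> real_of_int C})"

definition s_const :: "int \<Rightarrow> int" where
  "s_const C = max 4 (r_const C)"

definition D_rk :: "int \<Rightarrow> int" where
  "D_rk C = max 0 (C + s_const C - 1)"

definition J_rk :: "int \<Rightarrow> int" where
  "J_rk C = max (I_const 1) (s_const C)"

definition N_rk :: "int \<Rightarrow> int" where
  "N_rk C = J_rk C + D_rk C"

definition K_const :: "int \<Rightarrow> int" where
  "K_const C = Max ({2} \<union> {k. 3 \<le> k \<and> real_of_int (k * (k - 3)) / 2 \<le> real_of_int (C + 1)})"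

definition D_const :: "int \<Rightarrow> int" where
  "D_const C = Max {0, C + 3, C + K_const C}"

definition R_const :: "int \<Rightarrow> int" where
  "R_const C = max 4 (K_const C + 1)"

definition E_const :: "int \<Rightarrow> int" where
  "E_const C = D_const C + 1"

definition Q_const :: "int \<Rightarrow> nat" where
  "Q_const C = (LEAST q. 0 < q \<and> real q * (real q - 1) / 2 - 1 > real_of_int (D_const C))"

definition M_fun :: "int \<Rightarrow> int \<Rightarrow> int \<Rightarrow> int" where
  "M_fun h q E =
     max h (1 + \<lfloor>(1 + sqrt (9 + 8 * real_of_int (E + 2 * q + 2 * h))) / 2\<rfloor>)"

definition M_const :: "int \<Rightarrow> int" where
  "M_const C = M_fun 2 1 (E_const C)"

definition J_const :: "int \<Rightarrow> int" where
  "J_const C = Max {I_const 1, R_const C, M_const C, int (Q_const C)}"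

definition N_const :: "int \<Rightarrow> int" where
  "N_const C = Max {1 - C, N_rk C, J_const C + D_const C}"

lemma finite_r_set:
  "finite {r::int. 4 \<le> r \<and> real_of_int (r\<^sup>2 - 5 * r + 2) / 2 \<le> real_of_int C}"
proof (rule finite_subset)
  show "{r::int. 4 \<le> r \<and> real_of_int (r\<^sup>2 - 5 * r + 2) / 2 \<le> real_of_int C}
      \<subseteq> {4..2 * \<bar>C\<bar> + 5}"
  proof safe
    fix r :: int
    assume r: "4 \<le> r" and "real_of_int (r\<^sup>2 - 5 * r + 2) / 2 \<le> real_of_int C"
    then have le: "r * (r - 5) + 2 \<le> 2 * C"
      by (simp add: power2_eq_square algebra_simps flip: of_int_mult)
    show "r \<in> {4..2 * \<bar>C\<bar> + 5}"
    proof (cases "r \<le> 5")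
      case False
      then have "1 * (r - 5) \<le> r * (r - 5)" by (intro mult_right_mono) auto
      with le r show ?thesis by auto
    qed (use r in auto)
  qed
qed simp

lemma finite_K_set:
  "finite {k::int. 3 \<le> k \<and> real_of_int (k * (k - 3)) / 2 \<le> real_of_int (C + 1)}"
proof (rule finite_subset)
  show "{k::int. 3 \<le> k \<and> real_of_int (k * (k - 3)) / 2 \<le> real_of_int (C + 1)}
      \<subseteq> {3..2 * \<bar>C + 1\<bar> + 3}"
  proof safe
    fix k :: int
    assume k: "3 \<le> k" and le0: "real_of_int (k * (k - 3)) / 2 \<le> real_of_int (C + 1)"
    have "real_of_int (k * (k - 3)) \<le> real_of_int (2 * (C + 1))" using le0 by simp
    then have "k * (k - 3) \<le> 2 * (C + 1)" by (simp only: of_int_le_iff)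
    moreover have "1 * (k - 3) \<le> k * (k - 3)" using k by (intro mult_right_mono) auto
    ultimately show "k \<in> {3..2 * \<bar>C + 1\<bar> + 3}" using k by auto
  qed
qed simp

end

(* The word of (m, p) is accepted precisely when p is a partition of C + m or of C + m + 1. Let
   E = E_n(m, p). Padding p on the left with zeros to length n + 1 gives a list q such that
   E \<union> {m} = {q_i + i | 1 \<le> i \<le> n + 1} with q_i + i strictly increasing; hence E determines m (its
   least missing positive integer) and p, it has n elements, and its sum S is T_n + n + 1 + |p| - m.
   Every subset sum lies in {0..S}, but m is not a subset sum and neither, by complementation, is
   S - m, which gives the bound on the number of subset sums. Finally 3 and 4 lie in E, so E is
   primitive and a primitive dilate of E is E itself. *)

theory Submission
  imports Defs
begin

section \<open>Accepted words\<close>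

lemma sum_list_nonneg_of_pos: "(\<And>a::int. a \<in> set p \<Longrightarrow> 0 < a) \<Longrightarrow> 0 \<le> sum_list p"
  by (induction p) fastforce+

lemma length_le_sum_list: "(\<And>a::int. a \<in> set p \<Longrightarrow> 0 < a) \<Longrightarrow> int (length p) \<le> sum_list p"
proof (induction p)
  case (Cons a p)
  then have "int (length p) \<le> sum_list p" "0 < a" by auto
  then show ?case by simp
qed simp

text \<open>The last letter read, \<open>r\<close>, acts as an entry in front of \<open>p\<close>.
  Since the letters are positive, partial sums increase, so the cap on the final sum implies the cap
  at every intermediate state.\<close>

lemma foldl_step_parts:
  assumes "0 \<le> r" "s \<le> U C"
  shows "foldl (step C) (Node m r s) (map Part p) =
    (if sorted (r # p) \<and> (\<forall>a\<in>set p. 0 < a) \<and> s + sum_list p \<le> U C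
     then Node m (last (r # p)) (s + sum_list p) else Dead)"
  using assms
proof (induction p arbitrary: r s)
  case (Cons a p)
  show ?case
  proof (cases "max 1 r \<le> a \<and> s + a \<le> U C")
    case True
    then have "sorted (r # a # p) = sorted (a # p)" "0 < a" "0 \<le> a" "s + a \<le> U C" by auto
    with True Cons.IH[of a "s + a"] show ?thesis
      by (simp only: list.map foldl_Cons step.simps if_True) (auto simp: add.assoc)
  next
    case False
    have "\<not> (sorted (r # a # p) \<and> (\<forall>a\<in>set (a # p). 0 < a) \<and> s + sum_list (a # p) \<le> U C)"
    proof
      assume *: "sorted (r # a # p) \<and> (\<forall>a\<in>set (a # p). 0 < a) \<and> s + sum_list (a # p) \<le> U C"
      then have "0 \<le> sum_list p" by (auto intro: sum_list_nonneg_of_pos)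
      with * False show False by auto
    qed
    moreover have "foldl (step C) (Node m r s) (map Part (a # p)) = Dead"
      using False by (auto simp: foldl_step_Dead)
    ultimately show ?thesis by (simp only: if_False)
  qed
qed simp

text \<open>With \<open>C \<ge> -1\<close> and \<open>m\<close> at most 2, the weights
  \<open>C + m\<close> and \<open>C + m + 1\<close> both lie in \<open>{0..U C}\<close>, so the cap
  never kills the word of a partition of the right weight.\<close>

lemma word_accepted_iff:
  assumes "C \<ge> -1"
  shows "word m p \<in> accepted_words (automaton C) \<longleftrightarrow>
    m \<in> {1, 2} \<and> p \<in> partitions (C + m) \<union> partitions (C + m + 1)"
proof
  assume acc: "word m p \<in> accepted_words (automaton C)"
  then have m: "m \<in> {1, 2}" by (auto simp: accepted_words_def automaton_def word_def)
  from acc m obtain r s where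
    rs: "foldl (step C) (Node m 0 0) (map Part p) = Node m r s" "s \<in> W m C"
    using assms foldl_step_parts[of 0 0 C m p]
    by (auto simp: accepted_words_def automaton_def word_def U_def split: if_splits)
  have "0 \<le> U C" using assms by (simp add: U_def)
  with rs show "m \<in> {1, 2} \<and> p \<in> partitions (C + m) \<union> partitions (C + m + 1)"
    using m foldl_step_parts[of 0 0 C m p]
    by (auto simp: W_def partitions_def split: if_splits)
next
  assume R: "m \<in> {1, 2} \<and> p \<in> partitions (C + m) \<union> partitions (C + m + 1)"
  then have m: "m = 1 \<or> m = 2" and p: "sorted p" "\<forall>a\<in>set p. 0 < a"
    and sum: "sum_list p = C + m \<or> sum_list p = C + m + 1"
    by (auto simp: partitions_def)
  have U: "0 \<le> U C" "sum_list p \<le> U C" using assms m sum by (auto simp: U_def)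
  have le: "a \<in> {0..U C}" if "a \<in> set p" for a
    using that p U(2) member_le_sum_list[of a p] by force
  have "sorted (0 # p)" using p by auto
  then have "foldl (step C) (Node m 0 0) (map Part p) = Node m (last (0 # p)) (sum_list p)"
    using foldl_step_parts[of 0 0 C m p] p U by simp
  \<comment> \<open>For empty \<open>p\<close> this is the \<open>0\<close> of the state reached by
    the marker; otherwise it is a part, bounded by the whole sum.\<close>
  moreover have "last (0 # p) \<in> {0..U C}"
    using le[of "last p"] U by (cases p rule: rev_cases) auto
  moreover have "sum_list p \<in> {0..U C}" "sum_list p \<in> W m C"
    using assms sum m U by (auto simp: W_def)
  moreover have "a \<in> {1..U C}" if "a \<in> set p" for a
    using le[OF that] p that by force
  ultimately show "word m p \<in> accepted_words (automaton C)"
    using m by (force simp: accepted_words_def automaton_def word_def)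
qed


section \<open>Partitions as padded staircases\<close>

definition pad :: "nat \<Rightarrow> int list \<Rightarrow> int list" where
  "pad n p = replicate (n + 1 - length p) 0 @ p"

text \<open>Up to a shift by 1 these are the beta-numbers of \<open>p\<close> with
  \<open>n + 1\<close> rows, one row more than \<open>n\<close> because \<open>m\<close> will be
  deleted.\<close>

definition staircase :: "nat \<Rightarrow> int list \<Rightarrow> int list" where
  "staircase n p = map (\<lambda>i. int i + 1 + pad n p ! i) [0..<n + 1]"

lemma length_pad: "length p \<le> n \<Longrightarrow> length (pad n p) = n + 1"
  by (simp add: pad_def)

text \<open>Splitting the indices where the padding ends, the zeros yield the initial interval and
  the parts of \<open>p\<close> the remaining elements.\<close>

lemma set_staircase:
  assumes "length p \<le> n"
  shows "set (staircase n p) = {1..int n - int (length p) + 1} \<union>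
     {int n - int (length p) + int r + 1 + p ! (r - 1) | r. 1 \<le> r \<and> r \<le> length p}"
    (is "_ = ?L \<union> ?R")
proof -
  let ?k = "n + 1 - length p"
  have "{0..<n + 1} = {0..<?k} \<union> {?k..<n + 1}" using assms by auto
  then have "set (staircase n p) =
      (\<lambda>i. int i + 1 + pad n p ! i) ` {0..<?k} \<union> (\<lambda>i. int i + 1 + pad n p ! i) ` {?k..<n + 1}"
    by (simp only: staircase_def set_map set_upt image_Un)
  also have "(\<lambda>i. int i + 1 + pad n p ! i) ` {0..<?k} = (\<lambda>i. int i + 1) ` {0..<?k}"
    by (intro image_cong) (auto simp: pad_def nth_append)
  also have "\<dots> = ?L"
  proof safe
    fix x assume "x \<in> ?L"
    then show "x \<in> (\<lambda>i. int i + 1) ` {0..<?k}"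
      by (intro image_eqI[of _ _ "nat (x - 1)"]) auto
  qed (use assms in auto)
  \<comment> \<open>The r-th part sits at the 0-based position \<open>?k + r - 1\<close>, which
    gives the witnesses in both directions.\<close>
  also have "(\<lambda>i. int i + 1 + pad n p ! i) ` {?k..<n + 1} = ?R"
  proof safe
    fix i assume "i \<in> {?k..<n + 1}"
    then show "\<exists>r. int i + 1 + pad n p ! i = int n - int (length p) + int r + 1 + p ! (r - 1) \<and>
        1 \<le> r \<and> r \<le> length p"
      using assms by (intro exI[of _ "i + 1 - ?k"]) (auto simp: pad_def nth_append)
  next
    fix r assume "1 \<le> r" "r \<le> length p"
    then show "int n - int (length p) + int r + 1 + p ! (r - 1)
        \<in> (\<lambda>i. int i + 1 + pad n p ! i) ` {?k..<n + 1}"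
      using assms by (intro image_eqI[of _ _ "r - 1 + ?k"]) (auto simp: pad_def nth_append)
  qed
  finally show ?thesis .
qed

lemma strict_sorted_staircase:
  assumes "length p \<le> n" "p \<in> partitions w"
  shows "sorted_wrt (<) (staircase n p)"
proof -
  have "sorted (pad n p)"
    using assms by (auto simp: pad_def partitions_def sorted_append less_imp_le)
  then have "pad n p ! i \<le> pad n p ! j" if "i < j" "j < n + 1" for i j
    using that assms by (intro sorted_nth_mono) (auto simp: length_pad)
  then show ?thesis
    unfolding staircase_def sorted_wrt_map sorted_wrt_iff_nth_less
    by (auto intro!: add_less_le_mono simp del: upt_Suc)
qed

text \<open>A strictly increasing list is determined by its set, and subtracting the indices
  recovers the padded list. Parts are positive, so keeping the positive entries strips exactly the
  padding, whatever the two lengths are.\<close>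

lemma staircase_inj:
  assumes "length p \<le> n" "p \<in> partitions w" "length p' \<le> n" "p' \<in> partitions w'"
    and "set (staircase n p) = set (staircase n p')"
  shows "p = p'"
proof -
  have eq: "staircase n p = staircase n p'"
    using assms by (meson strict_sorted_equal strict_sorted_staircase)
  have "pad n p = pad n p'"
  proof (rule nth_equalityI)
    fix i assume "i < length (pad n p)"
    with assms arg_cong[OF eq, of "\<lambda>xs. xs ! i"] show "pad n p ! i = pad n p' ! i"
      by (simp add: length_pad staircase_def del: upt_Suc)
  qed (use assms in \<open>simp add: length_pad\<close>)
  then have "filter ((<) 0) (pad n p) = filter ((<) 0) (pad n p')" by simp
  moreover have "filter ((<) 0) (pad n p) = p" "filter ((<) 0) (pad n p') = p'"
    using assms by (auto simp: pad_def partitions_def filter_id_conv)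
  ultimately show ?thesis by simp
qed

lemma sum_list_staircase:
  assumes "length p \<le> n"
  shows "sum_list (staircase n p) = int (T n) + int n + 1 + sum_list p"
proof -
  have "sum_list (map (\<lambda>i. pad n p ! i) [0..<n + 1]) = sum_list (pad n p)"
    using map_nth[of "pad n p"] assms by (simp add: length_pad del: upt_Suc)
  also have "\<dots> = sum_list p" by (simp add: pad_def sum_list_replicate)
  finally have pad: "sum_list (map (\<lambda>i. pad n p ! i) [0..<n + 1]) = sum_list p" .
  \<comment> \<open>The indices contribute 1 + ... + (n + 1), the next triangular number after
    \<open>T n\<close>.\<close>
  have "sum_list (map (\<lambda>i. int i + 1) [0..<n + 1]) = int (T n) + int n + 1"
    by (induction n) (auto simp: T_def numeral_2_eq_2)
  with pad show ?thesis
    by (simp add: staircase_def sum_list_addf del: upt_Suc)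
qed

section \<open>Subset sums of a set of positive integers that misses 1 or 2\<close>

lemma FS_nonneg_le:
  fixes E :: "int set"
  assumes "finite E" "\<forall>x\<in>E. 0 < x" "y \<in> FS E"
  shows "0 \<le> y" "y \<le> \<Sum>E"
  using assms by (auto simp: FS_def less_imp_le subset_iff intro!: sum_nonneg sum_mono2)

lemma FS_diff:
  fixes E :: "int set"
  assumes "finite E" "\<Sum>E - y \<in> FS E"
  shows "y \<in> FS E"
proof -
  obtain X where X: "X \<subseteq> E" "\<Sum>E - y = \<Sum>X" using assms by (auto simp: FS_def)
  then have "y = \<Sum>(E - X)" using assms by (simp add: sum_diff)
  then show ?thesis by (auto simp: FS_def)
qed

text \<open>A subset with sum \<open>m\<close> would consist of positive integers below
  \<open>m\<close>, whose total is at most 0 for \<open>m = 1\<close> and 1 for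
  \<open>m = 2\<close>. The argument stops there, since 3 = 1 + 2.\<close>

lemma small_gap_not_in_FS:
  fixes E :: "int set"
  assumes "finite E" "\<forall>x\<in>E. 0 < x" "m \<notin> E" "m \<in> {1, 2}"
  shows "m \<notin> FS E"
proof
  assume "m \<in> FS E"
  then obtain X where X: "X \<subseteq> E" "m = \<Sum>X" by (auto simp: FS_def)
  have "x \<in> {1..m - 1}" if "x \<in> X" for x
  proof -
    have "x \<le> m" "x \<noteq> m" "0 < x"
      using X assms that finite_subset[OF X(1)]
      by (auto intro!: member_le_sum[of x X "\<lambda>x. x"] simp: less_imp_le subset_iff)
    then show ?thesis by auto
  qed
  then have "\<Sum>X \<le> \<Sum>{1..m - 1}" by (intro sum_mono2) auto
  then show False using X assms(4) by auto
qed

text \<open>Of the \<open>\<Sum>E + 1\<close> integers in \<open>{0..\<Sum>E}\<close>, two are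
  missed: \<open>2 * m < \<Sum>E\<close> makes \<open>m\<close> and \<open>\<Sum>E - m\<close>
  distinct elements of this interval.\<close>

lemma card_FS_le:
  fixes E :: "int set"
  assumes "finite E" "\<forall>x\<in>E. 0 < x" "m \<notin> E" "m \<in> {1, 2}" "2 * m < \<Sum>E"
  shows "int (card (FS E)) \<le> \<Sum>E - 1"
proof -
  have "FS E \<subseteq> {0..\<Sum>E} - {m, \<Sum>E - m}"
    using assms FS_nonneg_le small_gap_not_in_FS FS_diff[of E m] by fastforce
  then have "card (FS E) \<le> card ({0..\<Sum>E} - {m, \<Sum>E - m})" by (intro card_mono) auto
  also have "\<dots> = card {0..\<Sum>E} - card {m, \<Sum>E - m}"
    using assms by (intro card_Diff_subset) auto
  also have "card {m, \<Sum>E - m} = 2" using assms by auto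
  finally show ?thesis using assms by auto
qed

section \<open>The sets \<open>E_set n m p\<close> for \<open>n\<close> large compared with the
  weight\<close>

locale partition_set =
  fixes n :: nat and m w :: int and p :: "int list"
  assumes m: "m \<in> {1, 2}" and p: "p \<in> partitions w" and n: "w + 7 \<le> int n"
begin

text \<open>A partition of \<open>w\<close> has at most \<open>w\<close> parts, so the initial
  interval of the staircase contains 1, ..., 8.\<close>

lemma length_le: "int (length p) + 7 \<le> int n"
  using length_le_sum_list[of p] p n by (auto simp: partitions_def)

text \<open>The definition deletes \<open>m\<close> from the interval alone, but the other elements
  are at least 10, so deleting it from the union is the same.\<close>

lemma E_set_eq: "E_set n m p = set (staircase n p) - {m}"
  and initial_mem_staircase: "x \<in> {1..8} \<Longrightarrow> x \<in> set (staircase n p)"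
proof -
  have "x \<noteq> m" if "x = int n - int (length p) + int r + 1 + p ! (r - 1)" "1 \<le> r" "r \<le> length p" for x r
  proof -
    have "0 < p ! (r - 1)" using that p by (auto simp: partitions_def)
    with that length_le m show ?thesis by auto
  qed
  then show "E_set n m p = set (staircase n p) - {m}"
    using length_le by (subst set_staircase) (auto simp: E_set_def)
  show "x \<in> {1..8} \<Longrightarrow> x \<in> set (staircase n p)"
    using length_le by (subst set_staircase) auto
qed

lemma finite_E_set: "finite (E_set n m p)"
  by (simp add: E_set_eq)

lemma E_set_pos: "x \<in> E_set n m p \<Longrightarrow> 0 < x"
  using length_le p by (force simp: E_set_def partitions_def intro: add_nonneg_pos)

lemma m_mem_staircase: "m \<in> set (staircase n p)"
  using m initial_mem_staircase[of m] by auto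

text \<open>The consecutive elements 3 and 4 force gcd 1 and determine the factor of a dilate;
  membership of 1 reveals \<open>m\<close>.\<close>

lemma small_mem: "3 \<in> E_set n m p" "4 \<in> E_set n m p" "1 \<in> E_set n m p \<longleftrightarrow> m = 2"
  using m initial_mem_staircase by (auto simp: E_set_eq)

lemma distinct_staircase: "distinct (staircase n p)"
  using strict_sorted_staircase[OF _ p] length_le by (simp add: strict_sorted_iff)

lemma card_E_set: "card (E_set n m p) = n"
  using m_mem_staircase distinct_staircase
  by (simp add: E_set_eq card_Diff_singleton distinct_card) (simp add: staircase_def)

lemma sum_E_set: "\<Sum>(E_set n m p) = int (T n) + int n + 1 + w - m"
proof -
  have "\<Sum>(set (staircase n p)) = int (T n) + int n + 1 + w"
    using sum_list_staircase[of p n] length_le distinct_staircase p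
    by (simp add: sum_list_distinct_conv_sum_set[of _ "\<lambda>x. x", simplified] partitions_def)
  then show ?thesis using m_mem_staircase by (simp add: E_set_eq sum_diff1)
qed

lemma card_FS_E_set: "int (card (FS (E_set n m p))) \<le> int (T n) + int n + w - m"
proof -
  \<comment> \<open>The total is at least 7, hence exceeds \<open>2 * m\<close>, as
    \<open>card_FS_le\<close> requires.\<close>
  have "\<Sum>{3, 4} \<le> \<Sum>(E_set n m p)"
    using finite_E_set small_mem E_set_pos by (intro sum_mono2) (auto intro: less_imp_le)
  then have "int (card (FS (E_set n m p))) \<le> \<Sum>(E_set n m p) - 1"
    using m finite_E_set E_set_pos by (intro card_FS_le[of _ m]) (auto simp: E_set_eq)
  then show ?thesis by (simp add: sum_E_set)
qed

lemma primitive_E_set: "primitive (E_set n m p)"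
proof -
  have "Gcd (E_set n m p) dvd 4 - 3" using small_mem by (intro dvd_diff Gcd_dvd)
  then show ?thesis
    using finite_E_set E_set_pos by (simp add: primitive_def zdvd1_eq)
qed

text \<open>The factor is the difference of the dilates of 4 and 3, hence an integer; it divides
  every element of \<open>B\<close>, so it divides the gcd 1 and, being positive, equals 1.\<close>

lemma primitive_dilate:
  assumes B: "primitive B" "0 < l" "real_of_int ` B = (\<lambda>x. l * real_of_int x) ` E_set n m p"
  shows "B = E_set n m p"
proof -
  have "l * real_of_int 3 \<in> real_of_int ` B" "l * real_of_int 4 \<in> real_of_int ` B"
    unfolding B(3) using small_mem by blast+
  then obtain b c where "l * 3 = real_of_int b" "l * 4 = real_of_int c" by auto
  then have l: "l = real_of_int (c - b)" by simp
  have "real_of_int ` B = real_of_int ` (\<lambda>x. (c - b) * x) ` E_set n m p"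
    unfolding B(3) l by (simp add: image_image)
  then have Bimg: "B = (\<lambda>x. (c - b) * x) ` E_set n m p"
    by (simp add: inj_image_eq_iff inj_on_def)
  then have "c - b dvd Gcd B" by (auto intro: Gcd_greatest)
  with B l have "c - b = 1" by (auto simp: primitive_def zdvd1_eq)
  then show ?thesis using Bimg by simp
qed

end

text \<open>Membership of 1 gives \<open>m = m'\<close>; putting \<open>m\<close> back restores both
  staircases, and \<open>staircase_inj\<close> applies even if the weights differ.\<close>

lemma E_set_inj:
  assumes "partition_set n m w p" "partition_set n m' w' p'" "E_set n m p = E_set n m' p'"
  shows "m = m' \<and> p = p'"
proof -
  interpret a: partition_set n m w p by fact
  interpret b: partition_set n m' w' p' by fact
  have mm: "m = m'" using a.small_mem(3) b.small_mem(3) a.m b.m assms(3) by auto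
  have "set (staircase n p) = insert m (E_set n m p)"
    using a.m_mem_staircase by (auto simp: a.E_set_eq)
  also have "\<dots> = set (staircase n p')"
    unfolding assms(3) using b.m_mem_staircase mm by (auto simp: b.E_set_eq)
  finally have "p = p'"
    using a.length_le b.length_le by (intro staircase_inj[OF _ a.p _ b.p]) auto
  with mm show ?thesis ..
qed

section \<open>The threshold \<open>N_const C\<close> and the bijection\<close>

lemma N_const_ge: "C + 10 \<le> N_const C"
proof -
  \<comment> \<open>Here 7 is \<open>2 * E + 5\<close> at \<open>E = 1\<close>. Together with
    \<open>C + 3\<close>, the largest weight that occurs, it yields the margin required by
    \<open>partition_set\<close>.\<close>
  have "7 \<le> I_const 1" by (simp add: I_const_def)
  also have "\<dots> \<le> J_const C" unfolding J_const_def by (intro Max_ge) auto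
  finally have "7 \<le> J_const C" .
  moreover have "C + 3 \<le> D_const C" unfolding D_const_def by (intro Max_ge) auto
  moreover have "J_const C + D_const C \<le> N_const C" unfolding N_const_def by (intro Max_ge) auto
  ultimately show ?thesis by linarith
qed

theorem theorem7p3:
  fixes C :: int and n :: nat
  assumes "C \<ge> -1" and "int n \<ge> N_const C"
  shows "bij_betw (word_set n) (accepted_words (automaton C)) (exceptional C n)"
proof -
  have n: "C + 10 \<le> int n" using N_const_ge[of C] assms by linarith
  \<comment> \<open>The weight is at most \<open>C + 3\<close>, so \<open>n\<close> at least
    \<open>C + 10\<close> suffices; the bound on \<open>w\<close> is kept for counting subset
    sums.\<close>
  have acc: "\<exists>w. partition_set n m w p \<and> w \<le> C + m + 1"
    if "m \<in> {1, 2}" "p \<in> partitions (C + m) \<union> partitions (C + m + 1)" for m p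
    using that n by (force simp: partition_set_def)
  show ?thesis
  proof (rule bij_betw_imageI)
    show "inj_on (word_set n) (accepted_words (automaton C))"
    proof (rule inj_onI)
      fix u v
      assume uv: "u \<in> accepted_words (automaton C)" "v \<in> accepted_words (automaton C)"
        and eq: "word_set n u = word_set n v"
      obtain m p where u: "u = word m p" using accepted_word_form[OF uv(1)] by metis
      obtain m' p' where v: "v = word m' p'" using accepted_word_form[OF uv(2)] by metis
      from uv eq show "u = v"
        unfolding u v word_accepted_iff[OF assms(1)] word_set_word using acc E_set_inj by metis
    qed
  next
    show "word_set n ` accepted_words (automaton C) = exceptional C n"
    proof (intro equalityI subsetI)
      fix B assume "B \<in> word_set n ` accepted_words (automaton C)"
      then obtain m p where mp: "m \<in> {1, 2}" "p \<in> partitions (C + m) \<union> partitions (C + m + 1)"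
        and B: "B = E_set n m p"
        using accepted_word_form word_accepted_iff[OF assms(1)] word_set_word by (metis imageE)
      obtain w where "partition_set n m w p" and w: "w \<le> C + m + 1" using acc mp by blast
      then interpret partition_set n m w p by simp
      have "real_of_int ` B = (\<lambda>x. 1 * real_of_int x) ` E_set n m p" by (simp add: B)
      \<comment> \<open>Here \<open>w - m \<le> C + 1\<close> turns the bound in terms of
        \<open>w\<close> into the one for exceptional sets.\<close>
      moreover have "int (card (FS B)) \<le> int (T n) + int n + C + 1"
        using card_FS_E_set w by (simp add: B)
      ultimately show "B \<in> exceptional C n"
        unfolding exceptional_def using primitive_E_set card_E_set mp B zero_less_one by blast
    next
      fix B assume "B \<in> exceptional C n"
      then obtain l m p where mp: "m \<in> {1, 2}" "p \<in> partitions (C + m) \<union> partitions (C + m + 1)"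
        and B: "primitive B" "0 < l" "real_of_int ` B = (\<lambda>x. l * real_of_int x) ` E_set n m p"
        by (auto simp: exceptional_def)
      then have "B = word_set n (word m p)"
        using acc[OF mp] partition_set.primitive_dilate word_set_word by metis
      then show "B \<in> word_set n ` accepted_words (automaton C)"
        using mp word_accepted_iff[OF assms(1)] by blast
    qed
  qed
qed

end
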